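(* Let $x\geq 4$ be an even integer. Then there exists a standard linear realization of $\{1^a,x^b,(x+1)^c\}$ in each of the following cases: (1) $b,c\geq 0$ and $a\geq 3x-1$; (2) $b,c\geq 0$ and $a\geq c+2x-1$; (3) $b\geq c\geq 0$ and $a\geq 2x-1$.
   Context: The notation $\{1^{a_1},\ldots,t^{a_t}\}$ denotes the multiset with $a_i$ copies of $i$. For a list (multiset) $L$ of positive integers with $|L|$ elements, a linear realization of $L$ is an ordering $[x_0,\ldots,x_{|L|}]$ of $\{0,1,\ldots,|L|\}$ such that the multiset $\{|x_i-x_{i+1}|:0\le i\le |L|-1\}$ equals $L$; it is standard if $x_0=0$. All exponents are integers. *)

theory Defs
  imports "HOL-Library.Multiset"
begin

definition linear_realization :: "nat multiset \<Rightarrow> nat list \<Rightarrow> bool" where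
  "linear_realization L xs \<longleftrightarrow>
     distinct xs \<and> set xs = {0..size L} \<and>
     {# nat \<bar>int (xs ! i) - int (xs ! Suc i)\<bar>. i \<in># mset_set {0..<size L} #} = L"

definition standard_linear_realization :: "nat multiset \<Rightarrow> nat list \<Rightarrow> bool" where
  "standard_linear_realization L xs \<longleftrightarrow> linear_realization L xs \<and> xs ! 0 = 0"

end

theory Submission
  imports Defs
begin

text \<open>
  If a path through \<open>{0..n}\<close> contains the edge \<open>{i, i + 1}\<close> with \<open>i = n + 1 - y\<close>, then that edge can be
  replaced by the detour \<open>i, n + 1, n + 2, i + 1\<close>; this adds two differences \<open>y\<close> and creates the
  edge \<open>{n + 1, n + 2}\<close>. Since \<open>x\<close> is even, the top \<open>x\<close> vertices can be paired off by such edges, so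
  the detour with \<open>y = x\<close> can be iterated forever. Five explicit short paths, followed by detours
  with \<open>y = x + 1\<close> and then with \<open>y = x\<close>, realize \<open>{1\<^sup>x, x\<^sup>b, (x + 1)\<^sup>c}\<close> for all \<open>b\<close> and all \<open>c \<le> x\<close>.
  Larger \<open>c\<close> are reached by prefixing paths from \<open>0\<close> to their maximal vertex, which use the differences
  \<open>{1}\<close>, \<open>{x\<^sup>x, (x + 1)\<^bsup>x+1\<^esup>}\<close> (available when \<open>b \<ge> c\<close>) or \<open>{1\<^sup>x, (x + 1)\<^bsup>(x+1)k\<^esup>}\<close>.
\<close>

section \<open>Differences and edges of a path\<close>

fun diffs :: "nat list \<Rightarrow> nat multiset" where
  "diffs (u # v # r) = add_mset (nat \<bar>int u - int v\<bar>) (diffs (v # r))"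
| "diffs _ = {#}"

text \<open>Edges are unordered, so the direction in which a path runs through them is
  immaterial.\<close>

fun edges :: "nat list \<Rightarrow> nat set set" where
  "edges (u # v # r) = insert {u, v} (edges (v # r))"
| "edges _ = {}"

lemma diffs_split: "diffs (us @ v # vs) = diffs (us @ [v]) + diffs (v # vs)"
  by (induction us rule: diffs.induct) auto

lemma edges_split: "edges (us @ v # vs) = edges (us @ [v]) \<union> edges (v # vs)"
  by (induction us rule: edges.induct) auto

lemma diffs_snoc: "xs \<noteq> [] \<Longrightarrow> diffs (xs @ [v]) = add_mset (nat \<bar>int (last xs) - int v\<bar>) (diffs xs)"
  by (induction xs rule: diffs.induct) auto

lemma edges_snoc: "xs \<noteq> [] \<Longrightarrow> edges (xs @ [v]) = insert {last xs, v} (edges xs)"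
  by (induction xs rule: edges.induct) auto

lemma diffs_map_add: "diffs (map (\<lambda>v. v + m) xs) = diffs xs"
  by (induction xs rule: diffs.induct) auto

lemma size_diffs: "size (diffs xs) = length xs - 1"
  by (induction xs rule: diffs.induct) auto

text \<open>Links the recursion, convenient for surgery on lists, with the indexed form in
  \<open>linear_realization\<close>.\<close>

lemma diffs_conv_nth:
  "diffs xs = {# nat \<bar>int (xs ! i) - int (xs ! Suc i)\<bar>. i \<in># mset_set {0..<length xs - 1} #}"
proof (induction xs rule: diffs.induct)
  case (1 u v r)
  have "{0..<Suc (length r)} = insert 0 (Suc ` {0..<length r})"
    by (simp add: image_Suc_atLeastLessThan) auto
  moreover have "mset_set (Suc ` {0..<length r}) = image_mset Suc (mset_set {0..<length r})"
    by (simp add: image_mset_mset_set)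
  ultimately have "mset_set {0..<Suc (length r)} = add_mset 0 (image_mset Suc (mset_set {0..<length r}))"
    by simp
  then show ?case
    using 1 by (simp add: image_mset.compositionality o_def del: mset_set_upto_eq_mset_upto)
qed auto

lemma edges_mem_split:
  assumes "e \<in> edges xs"
  obtains us u v vs where "xs = us @ u # v # vs" "e = {u, v}"
proof -
  have "\<exists>us u v vs. xs = us @ u # v # vs \<and> e = {u, v}"
    using assms
  proof (induction xs rule: edges.induct)
    case (1 u v r)
    show ?case
    proof (cases "e = {u, v}")
      case True
      then show ?thesis by (intro exI[of _ "[]"]) auto
    next
      case False
      with 1 obtain us u' v' vs where "v # r = us @ u' # v' # vs" "e = {u', v'}"
        by auto
      then show ?thesis by (intro exI[of _ "u # us"]) auto
    qed
  qed auto
  then show thesis using that by blast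
qed

lemma diffs_rev_upt: "diffs (rev [p..<q]) = replicate_mset (q - p - 1) 1"
proof (induction q)
  case (Suc q)
  show ?case
  proof (cases "p < q")
    case True
    then obtain r where q: "q = Suc r" "p \<le> r" by (cases q) auto
    have "diffs (rev [p..<Suc q]) = add_mset 1 (diffs (rev [p..<q]))"
      using q by simp
    then show ?thesis using Suc q by (simp add: Suc_diff_le)
  qed (cases "p = q"; simp)
qed simp

lemma edges_rev_upt: "p \<le> i \<Longrightarrow> Suc i < q \<Longrightarrow> {i, Suc i} \<in> edges (rev [p..<q])"
proof (induction q)
  case (Suc q)
  then obtain r where q: "q = Suc r" "p \<le> r" by (cases q) auto
  have *: "edges (rev [p..<Suc q]) = insert {q, r} (edges (rev [p..<q]))"
    using q by simp
  show ?case
    using Suc q unfolding * by (cases "i = r") (auto simp: insert_commute)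
qed simp

section \<open>Hamiltonian paths with prescribed edges\<close>

text \<open>\<open>E\<close> holds lower ends of unit edges guaranteed to lie on the path, not
  necessarily of all of them: the stock available for detours. The endpoint \<open>l\<close> is
  tracked because paths are extended there and prefixes must end in their maximal vertex.\<close>

definition ham_path :: "nat \<Rightarrow> nat set \<Rightarrow> nat \<Rightarrow> nat multiset \<Rightarrow> bool" where
  "ham_path n E l L \<longleftrightarrow> (\<exists>xs. xs \<noteq> [] \<and> hd xs = 0 \<and> last xs = l \<and> distinct xs \<and> set xs = {0..n} \<and>
     diffs xs = L \<and> (\<forall>i\<in>E. {i, Suc i} \<in> edges xs))"

lemma ham_path_mono: "ham_path n E l L \<Longrightarrow> F \<subseteq> E \<Longrightarrow> ham_path n F l L"
  unfolding ham_path_def by blast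

lemma ham_path_0: "ham_path 0 {} 0 {#}"
  unfolding ham_path_def by (intro exI[of _ "[0]"]) auto

lemma ham_path_append:
  assumes "ham_path n E l L" "l \<le> n"
  shows "ham_path (Suc n) (E \<union> (if l = n then {n} else {})) (Suc n) (add_mset (Suc n - l) L)"
proof -
  obtain xs where xs: "xs \<noteq> []" "hd xs = 0" "last xs = l" "distinct xs" "set xs = {0..n}"
    "diffs xs = L" "\<forall>i\<in>E. {i, Suc i} \<in> edges xs"
    using assms unfolding ham_path_def by blast
  have "nat \<bar>int l - int (Suc n)\<bar> = Suc n - l" using assms by auto
  then show ?thesis
    unfolding ham_path_def using xs
    by (intro exI[of _ "xs @ [Suc n]"]) (auto simp: diffs_snoc edges_snoc)
qed

lemma ham_path_run: "ham_path n {..<n} n (replicate_mset n 1)"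
proof (induction n)
  case 0
  show ?case using ham_path_0 by simp
next
  case (Suc n)
  from ham_path_append[OF this] show ?case by (simp add: lessThan_Suc)
qed

text \<open>The edge at \<open>i\<close> is spent and the one at \<open>n + 1\<close> is gained; all
  other recorded edges and both endpoints survive, which permits iteration.\<close>

lemma ham_path_detour:
  assumes "ham_path n E l L" "i \<in> E" "i + y = Suc n"
  shows "ham_path (n + 2) (insert (Suc n) (E - {i})) l (L + replicate_mset 2 y)"
proof -
  obtain xs where xs: "xs \<noteq> []" "hd xs = 0" "last xs = l" "distinct xs" "set xs = {0..n}"
    "diffs xs = L" "\<forall>i\<in>E. {i, Suc i} \<in> edges xs"
    using assms unfolding ham_path_def by blast
  obtain us u v vs where uv: "xs = us @ u # v # vs" "{i, Suc i} = {u, v}"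
    using xs(7) assms(2) edges_mem_split by metis
  then have cases: "u = i \<and> v = Suc i \<or> u = Suc i \<and> v = i"
    by (auto simp: doubleton_eq_iff)
  \<comment> \<open>Shifting \<open>u\<close> and \<open>v\<close> by \<open>y\<close> yields the
    two new vertices in the right order for either orientation of the edge.\<close>
  define ys where "ys = us @ u # (u + y) # (v + y) # v # vs"
  have new: "u + y = Suc n \<and> v + y = n + 2 \<or> u + y = n + 2 \<and> v + y = Suc n"
    using cases assms(3) by auto
  have "diffs ys = L + replicate_mset 2 y"
  proof -
    have "diffs ys = diffs (us @ [u]) + add_mset y (add_mset 1 (add_mset y (diffs (v # vs))))"
      unfolding ys_def diffs_split[of us u "_ # _"] using cases by auto
    moreover have "L = diffs (us @ [u]) + add_mset 1 (diffs (v # vs))"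
      unfolding xs(6)[symmetric] uv(1) diffs_split[of us u "_ # _"] using cases by auto
    ultimately show ?thesis by (simp add: numeral_2_eq_2)
  qed
  moreover have "{j, Suc j} \<in> edges ys" if "j \<in> insert (Suc n) (E - {i})" for j
  proof (cases "j = Suc n")
    case True
    then have "{j, Suc j} = {u + y, v + y}" using new by (auto simp: insert_commute)
    then show ?thesis unfolding ys_def edges_split[of us u "_ # _"] by auto
  next
    case False
    then have j: "{j, Suc j} \<in> edges xs" "j \<noteq> i" using that xs(7) by auto
    then have "{j, Suc j} \<noteq> {u, v}" using uv(2) by (auto simp: doubleton_eq_iff)
    with j(1) show ?thesis
      unfolding ys_def uv(1) edges_split[of us u "_ # _"] by auto
  qed
  moreover have "set ys = insert (Suc n) (insert (n + 2) (set xs))"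
    unfolding ys_def uv(1) using new by auto
  then have "set ys = {0..n + 2}" using xs(5) by auto
  moreover have "distinct ys"
  proof -
    have "Suc n \<notin> set xs" "n + 2 \<notin> set xs" using xs(5) by auto
    then show ?thesis using xs(4) new unfolding ys_def uv(1) by auto
  qed
  moreover have "ys \<noteq> []" "hd ys = 0" "last ys = l"
    using xs(2,3) unfolding ys_def uv(1) by (cases us; auto)+
  ultimately show ?thesis unfolding ham_path_def by blast
qed

text \<open>Each detour raises the maximal vertex by 2, so the next one with the same
  \<open>y\<close> starts 2 higher. Since \<open>2 * j \<le> y\<close>, all spent edges start below
  \<open>Suc n\<close>, and no freshly created edge is spent.\<close>

lemma ham_path_detours:
  assumes "ham_path n E l L" "d + y = Suc n" "2 * j \<le> y" "\<And>k. k < j \<Longrightarrow> d + 2 * k \<in> E"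
  shows "ham_path (n + 2 * j) ((\<lambda>k. Suc n + 2 * k) ` {..<j} \<union> (E - (\<lambda>k. d + 2 * k) ` {..<j})) l
    (L + replicate_mset (2 * j) y)"
  using assms(3,4)
proof (induction j)
  case 0
  then show ?case using assms by simp
next
  case (Suc j)
  have "ham_path (n + 2 * j) ((\<lambda>k. Suc n + 2 * k) ` {..<j} \<union> (E - (\<lambda>k. d + 2 * k) ` {..<j})) l
    (L + replicate_mset (2 * j) y)"
    using Suc by simp
  moreover have "d + 2 * j \<in> (\<lambda>k. Suc n + 2 * k) ` {..<j} \<union> (E - (\<lambda>k. d + 2 * k) ` {..<j})"
    using Suc.prems(2)[of j] by auto
  moreover have "d + 2 * j + y = Suc (n + 2 * j)" using assms(2) by simp
  ultimately have "ham_path (n + 2 * j + 2) (insert (Suc (n + 2 * j))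
      ((\<lambda>k. Suc n + 2 * k) ` {..<j} \<union> (E - (\<lambda>k. d + 2 * k) ` {..<j}) - {d + 2 * j})) l
      (L + replicate_mset (2 * j) y + replicate_mset 2 y)"
    by (rule ham_path_detour)
  moreover have "(\<lambda>k. Suc n + 2 * k) ` {..<Suc j} \<union> (E - (\<lambda>k. d + 2 * k) ` {..<Suc j})
      \<subseteq> insert (Suc (n + 2 * j))
      ((\<lambda>k. Suc n + 2 * k) ` {..<j} \<union> (E - (\<lambda>k. d + 2 * k) ` {..<j}) - {d + 2 * j})"
    using assms(2) Suc.prems(1) by (auto simp: lessThan_Suc)
  moreover have "L + replicate_mset (2 * j) y + replicate_mset 2 y = L + replicate_mset (2 * Suc j) y"
    by (simp add: numeral_2_eq_2)
  ultimately have "ham_path (n + 2 * j + 2) ((\<lambda>k. Suc n + 2 * k) ` {..<Suc j} \<union>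
      (E - (\<lambda>k. d + 2 * k) ` {..<Suc j})) l (L + replicate_mset (2 * Suc j) y)"
    using ham_path_mono by simp
  then show ?case by (simp add: add.assoc add.commute)
qed

text \<open>Invariant: unit edges pair off the top \<open>2 * h\<close> vertices. A detour with
  \<open>y = 2 * h\<close> spends the lowest pair and adds a pair on top, so the window merely moves
  up by 2.\<close>

lemma ham_path_detours_unbounded:
  assumes "ham_path (d + 2 * h) ((\<lambda>k. Suc d + 2 * k) ` {..<h}) l L" "h > 0"
  shows "\<exists>n E. ham_path n E l (L + replicate_mset (2 * m) (2 * h))"
proof -
  have "ham_path (d + 2 * m + 2 * h) ((\<lambda>k. Suc (d + 2 * m) + 2 * k) ` {..<h}) l
    (L + replicate_mset (2 * m) (2 * h))"
  proof (induction m)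
    case 0
    then show ?case using assms by simp
  next
    case (Suc m)
    have "Suc (d + 2 * m) \<in> (\<lambda>k. Suc (d + 2 * m) + 2 * k) ` {..<h}"
      using assms(2) by (intro image_eqI[of _ _ 0]) auto
    from ham_path_detour[OF Suc this, of "2 * h"]
    have "ham_path (d + 2 * m + 2 * h + 2) (insert (Suc (d + 2 * m + 2 * h))
      ((\<lambda>k. Suc (d + 2 * m) + 2 * k) ` {..<h} - {Suc (d + 2 * m)})) l
      (L + replicate_mset (2 * m) (2 * h) + replicate_mset 2 (2 * h))"
      by simp
    moreover have "(\<lambda>k. Suc (d + 2 * Suc m) + 2 * k) ` {..<h} \<subseteq> insert (Suc (d + 2 * m + 2 * h))
      ((\<lambda>k. Suc (d + 2 * m) + 2 * k) ` {..<h} - {Suc (d + 2 * m)})"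
    proof (intro image_subsetI)
      fix k assume k: "k \<in> {..<h}"
      show "Suc (d + 2 * Suc m) + 2 * k \<in> insert (Suc (d + 2 * m + 2 * h))
        ((\<lambda>k. Suc (d + 2 * m) + 2 * k) ` {..<h} - {Suc (d + 2 * m)})"
      \<comment> \<open>Pair \<open>k\<close> of the new window is pair \<open>k + 1\<close> of the
        old one, except the topmost, which the detour created.\<close>
      proof (cases "Suc k = h")
        case False
        then show ?thesis using k by (auto intro!: image_eqI[of _ _ "Suc k"])
      qed auto
    qed
    ultimately have "ham_path (d + 2 * m + 2 * h + 2) ((\<lambda>k. Suc (d + 2 * Suc m) + 2 * k) ` {..<h}) l
      (L + replicate_mset (2 * m) (2 * h) + replicate_mset 2 (2 * h))"
      by (rule ham_path_mono)
    then show ?case by (simp add: numeral_2_eq_2 add_ac)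
  qed
  then show ?thesis by blast
qed

text \<open>The detours of difference \<open>2 * h + 1\<close> spend edges at even offsets from
  \<open>d\<close>. The edges at odd offsets and the newly created ones then pair off the top
  \<open>2 * h\<close> vertices, so detours of difference \<open>2 * h\<close> can follow.\<close>

lemma ham_path_grow:
  assumes "ham_path (d + 2 * h) E l L" "h > 0" "j \<le> h"
    and "\<And>k. k < j \<Longrightarrow> d + 2 * k \<in> E" "\<And>k. j \<le> k \<Longrightarrow> k < h \<Longrightarrow> Suc d + 2 * k \<in> E"
  shows "\<exists>n E. ham_path n E l (L + replicate_mset (2 * m) (2 * h) + replicate_mset (2 * j) (2 * h + 1))"
proof -
  have "ham_path (d + 2 * h + 2 * j)
     ((\<lambda>k. Suc (d + 2 * h) + 2 * k) ` {..<j} \<union> (E - (\<lambda>k. d + 2 * k) ` {..<j})) l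
    (L + replicate_mset (2 * j) (2 * h + 1))"
    using assms by (intro ham_path_detours) auto
  moreover have "(\<lambda>k. Suc (d + 2 * j) + 2 * k) ` {..<h}
    \<subseteq> (\<lambda>k. Suc (d + 2 * h) + 2 * k) ` {..<j} \<union> (E - (\<lambda>k. d + 2 * k) ` {..<j})"
  proof (intro image_subsetI)
    fix k assume k: "k \<in> {..<h}"
    show "Suc (d + 2 * j) + 2 * k \<in> (\<lambda>k. Suc (d + 2 * h) + 2 * k) ` {..<j} \<union> (E - (\<lambda>k. d + 2 * k) ` {..<j})"
    \<comment> \<open>Pairs below the old maximum are old edges, unspent by parity; the others were
      created by the detours.\<close>
    proof (cases "j + k < h")
      case True
      then have "Suc (d + 2 * j) + 2 * k \<in> E" using assms(5)[of "j + k"] by (simp add: algebra_simps)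
      moreover have "Suc (d + 2 * j) + 2 * k \<notin> (\<lambda>k. d + 2 * k) ` {..<j}"
        by auto
      ultimately show ?thesis by blast
    next
      case False
      then show ?thesis using k by (auto intro!: image_eqI[of _ _ "j + k - h"])
    qed
  qed
  ultimately have "ham_path (d + 2 * h + 2 * j) ((\<lambda>k. Suc (d + 2 * j) + 2 * k) ` {..<h}) l
    (L + replicate_mset (2 * j) (2 * h + 1))"
    by (rule ham_path_mono)
  moreover have "d + 2 * h + 2 * j = d + 2 * j + 2 * h" by simp
  ultimately have "ham_path (d + 2 * j + 2 * h) ((\<lambda>k. Suc (d + 2 * j) + 2 * k) ` {..<h}) l
    (L + replicate_mset (2 * j) (2 * h + 1))"
    by (simp only:)
  from ham_path_detours_unbounded[OF this assms(2), of m] show ?thesis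
    by (simp add: add_ac)
qed

section \<open>Standard realizations with few differences \<open>x + 1\<close>\<close>

text \<open>The path \<open>0, m + 1, m, ..., 1\<close>.\<close>

lemma ham_path_down: "ham_path (Suc m) {1..m} 1 (add_mset (Suc m) (replicate_mset m 1))"
  unfolding ham_path_def
proof (intro exI[of _ "0 # rev [1..<Suc (Suc m)]"] conjI ballI)
  show "diffs (0 # rev [1..<Suc (Suc m)]) = add_mset (Suc m) (replicate_mset m 1)"
    using diffs_rev_upt[of 1 "Suc (Suc m)"] by simp
  fix i assume "i \<in> {1..m}"
  then have "{i, Suc i} \<in> edges (rev [1..<Suc (Suc m)])"
    by (intro edges_rev_upt) auto
  then show "{i, Suc i} \<in> edges (0 # rev [1..<Suc (Suc m)])" by simp
qed (auto simp: last_rev simp del: upt_Suc)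

text \<open>Jumping to \<open>n + 2\<close> and stepping back to \<open>n + 1\<close> puts a unit
  edge on top.\<close>

lemma ham_path_append_pair:
  assumes "ham_path n E l L" "l \<le> n"
  shows "ham_path (n + 2) (insert (n + 1) E) (n + 1) (L + {#n + 2 - l, 1#})"
proof -
  obtain xs where xs: "xs \<noteq> []" "hd xs = 0" "last xs = l" "distinct xs" "set xs = {0..n}"
    "diffs xs = L" "\<forall>i\<in>E. {i, Suc i} \<in> edges xs"
    using assms unfolding ham_path_def by blast
  define ys where "ys = (xs @ [n + 2]) @ [n + 1]"
  have "nat \<bar>int l - int (n + 2)\<bar> = n + 2 - l" using assms(2) by auto
  then have "diffs ys = L + {#n + 2 - l, 1#}"
    unfolding ys_def using xs by (simp add: diffs_snoc del: append_assoc)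
  moreover have "edges ys = edges xs \<union> {{l, n + 2}, {n + 2, n + 1}}"
    unfolding ys_def using xs by (auto simp: edges_snoc simp del: append_assoc)
  ultimately show ?thesis
    unfolding ham_path_def using xs
    by (intro exI[of _ ys]) (auto simp: ys_def insert_commute)
qed

text \<open>The path \<open>0, x + 1, x, ..., 3, x + 3, x + 2, 1, 2\<close>, the base for odd
  \<open>b\<close> and even positive \<open>c\<close>.\<close>

lemma ham_path_two_long:
  assumes "x \<ge> 2"
  shows "ham_path (x + 3) (insert 1 (insert (x + 2) {3..x})) 2
    (replicate_mset x 1 + {#x#} + replicate_mset 2 (x + 1))"
proof -
  define xs where "xs = 0 # rev [3..<x + 2]"
  define ys where "ys = (((xs @ [x + 3]) @ [x + 2]) @ [1]) @ [2]"
  have up: "rev [3..<x + 2] = (x + 1) # rev [3..<x + 1]" using assms by simp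
  have last: "xs \<noteq> []" "last xs = 3" unfolding xs_def using assms by (auto simp: last_rev simp del: upt_Suc)
  have "diffs xs = add_mset (x + 1) (diffs (rev [3..<x + 2]))"
    unfolding xs_def up by simp
  then have dx: "diffs xs = add_mset (x + 1) (replicate_mset (x - 2) 1)"
    unfolding diffs_rev_upt using assms by (simp add: numeral_2_eq_2)
  obtain z where z: "x = z + 2" using assms by (metis le_add_diff_inverse2)
  have "diffs ys = add_mset 1 (add_mset (x + 1) (add_mset 1 (add_mset x (diffs xs))))"
    unfolding ys_def using last by (simp add: diffs_snoc del: append_assoc)
  then have "diffs ys = replicate_mset x 1 + {#x#} + replicate_mset 2 (x + 1)"
    unfolding dx z by (simp add: numeral_2_eq_2)
  moreover have "\<forall>i\<in>insert 1 (insert (x + 2) {3..x}). {i, Suc i} \<in> edges ys"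
  proof -
    have "edges ys = edges xs \<union> {{3, x + 3}, {x + 3, x + 2}, {x + 2, 1}, {1, 2}}"
      unfolding ys_def using last by (auto simp: edges_snoc simp del: append_assoc)
    moreover have "{i, Suc i} \<in> edges xs" if "i \<in> {3..x}" for i
      using edges_rev_upt[of 3 i "x + 2"] that unfolding xs_def up by auto
    moreover have "{1, Suc 1} = {1, 2 :: nat}" "{x + 2, Suc (x + 2)} = {x + 3, x + 2}"
      by auto
    ultimately show ?thesis by blast
  qed
  moreover have "set ys = {0, 1, 2} \<union> {3..<x + 2} \<union> {x + 2, x + 3}"
    unfolding ys_def xs_def by (auto simp del: upt_Suc)
  then have "set ys = {0..x + 3}"
    using assms by (intro set_eqI) (simp, presburger)
  moreover have "distinct ys"
    unfolding ys_def xs_def using assms by (auto simp del: upt_Suc)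
  moreover have "ys \<noteq> []" "hd ys = 0" "last ys = 2"
    unfolding ys_def xs_def by simp_all
  ultimately show ?thesis unfolding ham_path_def by blast
qed

text \<open>Detours add differences in pairs, so the base path must fix the parities of
  \<open>b\<close> and \<open>c\<close>. At most \<open>h\<close> detours of difference
  \<open>x + 1\<close> are possible, whence \<open>c \<le> x\<close>.\<close>

lemma ham_path_few_long:
  assumes "even x" "x > 0" "c \<le> x"
  shows "\<exists>n E l a. a \<le> x \<and>
    ham_path n E l (replicate_mset a 1 + replicate_mset b x + replicate_mset c (x + 1))"
proof -
  obtain h where x: "x = 2 * h" using assms(1) by blast
  with assms have h: "h > 0" by simp
  define m where "m = b div 2"
  have b: "b = 2 * m \<or> b = Suc (2 * m)" unfolding m_def by arith
  define i where "i = c div 2"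
  have c: "c = 2 * i \<or> c = Suc (2 * i)" unfolding i_def by arith
  \<comment> \<open>For odd \<open>b\<close> and even \<open>c\<close>, the base of
    \<open>o0\<close> lacks the edge \<open>{0, 1}\<close> with which detours of difference
    \<open>x + 1\<close> would begin; hence the separate case \<open>oe\<close>.\<close>
  consider
      (ee) j where "b = 2 * m" "c = 2 * j" "j \<le> h"
    | (eo) j where "b = 2 * m" "c = Suc (2 * j)" "j < h"
    | (o0) "b = Suc (2 * m)" "c = 0"
    | (oe) j where "b = Suc (2 * m)" "c = 2 * j + 2" "j < h"
    | (oo) j where "b = Suc (2 * m)" "c = Suc (2 * j)" "j < h"
  proof (cases i)
    case 0
    then show ?thesis using that(1,2)[of 0] that(3) that(5)[of 0] b c h by auto
  next
    case (Suc j)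
    then show ?thesis using that(1,2)[of i] that(4)[of j] that(5)[of i] b c assms(3) x by auto
  qed
  then show ?thesis
  proof cases
    case ee
    have base: "ham_path (0 + 2 * h) {..<x} x (replicate_mset x 1)"
      using ham_path_run[of x] x by simp
    have "0 + 2 * k \<in> {..<x}" if "k < j" for k using that ee x by auto
    moreover have "Suc 0 + 2 * k \<in> {..<x}" if "k < h" for k using that x by auto
    ultimately have "\<exists>n E. ham_path n E x
      (replicate_mset x 1 + replicate_mset (2 * m) (2 * h) + replicate_mset (2 * j) (2 * h + 1))"
      using h ee(3) by (intro ham_path_grow[OF base]) auto
    moreover have "x \<le> x" by simp
    ultimately show ?thesis unfolding ee(1,2) x by blast
  next
    case eo
    \<comment> \<open>The initial drop supplies the odd \<open>x + 1\<close>.\<close>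
    have base: "ham_path (1 + 2 * h) {1..x} 1 (add_mset (x + 1) (replicate_mset x 1))"
      using ham_path_down[of x] x by simp
    have "1 + 2 * k \<in> {1..x}" if "k < j" for k using that eo x by auto
    moreover have "Suc 1 + 2 * k \<in> {1..x}" if "k < h" for k using that x by auto
    ultimately have "\<exists>n E. ham_path n E 1 (add_mset (x + 1) (replicate_mset x 1)
      + replicate_mset (2 * m) (2 * h) + replicate_mset (2 * j) (2 * h + 1))"
      using h eo(3) by (intro ham_path_grow[OF base]) auto
    moreover have "add_mset (x + 1) (replicate_mset x 1)
        + replicate_mset (2 * m) (2 * h) + replicate_mset (2 * j) (2 * h + 1)
      = replicate_mset x 1 + replicate_mset b x + replicate_mset c (x + 1)"
      unfolding eo(1,2) x by simp
    moreover have "x \<le> x" by simp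
    ultimately show ?thesis by metis
  next
    case o0
    obtain y where y: "x = Suc y" using assms(2) by (cases x) auto
    \<comment> \<open>The initial drop supplies the odd \<open>x\<close>; this is the only base with
      \<open>x - 1\<close> ones instead of \<open>x\<close>.\<close>
    have base: "ham_path (0 + 2 * h) {1..y} 1 (add_mset x (replicate_mset y 1))"
      using ham_path_down[of y] x y by simp
    have "Suc 0 + 2 * k \<in> {1..y}" if "k < h" for k using that x y by auto
    then have "\<exists>n E. ham_path n E 1 (add_mset x (replicate_mset y 1)
      + replicate_mset (2 * m) (2 * h) + replicate_mset (2 * 0) (2 * h + 1))"
      using h by (intro ham_path_grow[OF base]) auto
    moreover have "add_mset x (replicate_mset y 1)
        + replicate_mset (2 * m) (2 * h) + replicate_mset (2 * 0) (2 * h + 1)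
      = replicate_mset y 1 + replicate_mset b x + replicate_mset c (x + 1)"
      unfolding o0 x by simp
    moreover have "y \<le> x" using y by simp
    ultimately show ?thesis by metis
  next
    case oe
    have base: "ham_path (3 + 2 * h) (insert 1 (insert (x + 2) {3..x})) 2
      (replicate_mset x 1 + {#x#} + replicate_mset 2 (x + 1))"
      using ham_path_two_long[of x] x h by (simp add: add.commute)
    have "3 + 2 * k \<in> insert 1 (insert (x + 2) {3..x})" if "k < j" for k
      using that oe x by auto
    moreover have "Suc 3 + 2 * k \<in> insert 1 (insert (x + 2) {3..x})" if "k < h" for k
      \<comment> \<open>The topmost pair is the isolated edge \<open>{x + 2, x + 3}\<close>.\<close>
      using that x by (cases "Suc k = h") auto
    ultimately have "\<exists>n E. ham_path n E 2 (replicate_mset x 1 + {#x#} + replicate_mset 2 (x + 1)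
      + replicate_mset (2 * m) (2 * h) + replicate_mset (2 * j) (2 * h + 1))"
      using h oe(3) by (intro ham_path_grow[OF base]) auto
    moreover have "replicate_mset x 1 + {#x#} + replicate_mset 2 (x + 1)
        + replicate_mset (2 * m) (2 * h) + replicate_mset (2 * j) (2 * h + 1)
      = replicate_mset x 1 + replicate_mset b x + replicate_mset c (x + 1)"
      unfolding oe(1,2) x by (simp add: numeral_2_eq_2)
    moreover have "x \<le> x" by simp
    ultimately show ?thesis by metis
  next
    case oo
    obtain y where y: "x = Suc y" using assms(2) by (cases x) auto
    \<comment> \<open>The path \<open>0, x, ..., 1, x + 2, x + 1\<close>, with one \<open>x\<close>
      and one \<open>x + 1\<close>.\<close>
    have base: "ham_path (2 + 2 * h) (insert (x + 1) {1..y}) (x + 1)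
      (add_mset x (replicate_mset y 1) + {#x + 1, 1#})"
      using ham_path_append_pair[OF ham_path_down[of y]] x y by (simp add: add.commute)
    have "2 + 2 * k \<in> insert (x + 1) {1..y}" if "k < j" for k
      using that oo x y by auto
    moreover have "Suc 2 + 2 * k \<in> insert (x + 1) {1..y}" if "k < h" for k
      using that x y by (cases "Suc k = h") auto
    ultimately have "\<exists>n E. ham_path n E (x + 1) (add_mset x (replicate_mset y 1) + {#x + 1, 1#}
      + replicate_mset (2 * m) (2 * h) + replicate_mset (2 * j) (2 * h + 1))"
      using h oo(3) by (intro ham_path_grow[OF base]) auto
    moreover have "add_mset x (replicate_mset y 1) + {#x + 1, 1#}
        + replicate_mset (2 * m) (2 * h) + replicate_mset (2 * j) (2 * h + 1)
      = replicate_mset x 1 + replicate_mset b x + replicate_mset c (x + 1)"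
      unfolding oo(1,2) y[symmetric] by (simp add: x[symmetric] y)
    moreover have "x \<le> x" by simp
    ultimately show ?thesis by metis
  qed
qed

lemma replicate_mset_plus: "replicate_mset (m + n) y = replicate_mset m y + replicate_mset n y"
  by (induction m) auto

section \<open>Prefixes ending in their maximal vertex\<close>

text \<open>The second path is shifted by \<open>m\<close> and glued at the vertex \<open>m\<close>.
  Unit edges are forgotten, as detours are made only before gluing.\<close>

lemma ham_path_concat:
  assumes "ham_path m E m L" "ham_path n F l M"
  shows "ham_path (m + n) {} (m + l) (L + M)"
proof -
  obtain xs where xs: "xs \<noteq> []" "hd xs = 0" "last xs = m" "distinct xs" "set xs = {0..m}" "diffs xs = L"
    using assms unfolding ham_path_def by blast
  obtain us where us: "xs = us @ [m]" using xs(1,3) append_butlast_last_id by metis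
  obtain ys where ys: "ys \<noteq> []" "hd ys = 0" "last ys = l" "distinct ys" "set ys = {0..n}" "diffs ys = M"
    using assms unfolding ham_path_def by blast
  obtain vs where vs: "ys = 0 # vs" using ys(1,2) by (cases ys) auto
  define zs where "zs = us @ map (\<lambda>v. v + m) ys"
  have zs: "zs = us @ m # map (\<lambda>v. v + m) vs" "zs = xs @ map (\<lambda>v. v + m) vs"
    unfolding zs_def vs us by auto
  have set_vs: "set vs = {1..n}"
  proof -
    have "set vs = set ys - {0}" using ys(4) unfolding vs by auto
    then show ?thesis using ys(5) by auto
  qed
  have "diffs zs = L + M"
    unfolding zs(1) diffs_split[of us m "map _ _"]
    using xs(6) ys(6) diffs_map_add[of m ys] unfolding us vs by simp
  moreover have "set zs = {0..m + n}"
  proof -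
    have "(\<lambda>v. v + m) ` {1..n} = {1 + m..n + m}" by simp
    then show ?thesis unfolding zs(2) using xs(5) set_vs by auto
  qed
  moreover have "distinct zs"
    unfolding zs(2) using xs(4,5) set_vs ys(4) vs by (auto simp: distinct_map)
  moreover have "zs \<noteq> []" "hd zs = 0" unfolding zs(2) using xs(1,2) by auto
  moreover have "last zs = m + l" unfolding zs_def using ys(1,3) by (simp add: last_map)
  ultimately show ?thesis unfolding ham_path_def by blast
qed

text \<open>The path \<open>0, x + 1, 1, x + 2, ..., x, 2 * x + 1\<close> alternates steps up by
  \<open>x + 1\<close> and down by \<open>x\<close>.\<close>

lemma ham_path_zigzag:
  "ham_path (2 * x + 1) {} (2 * x + 1) (replicate_mset x x + replicate_mset (x + 1) (x + 1))"
proof -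
  \<comment> \<open>The initial segments fill two blocks from below; \<open>k \<le> x\<close> keeps
    the blocks disjoint, and at \<open>k = x\<close> they meet.\<close>
  have "\<exists>xs. xs \<noteq> [] \<and> hd xs = 0 \<and> last xs = x + 1 + k \<and> distinct xs \<and>
      set xs = {0..k} \<union> {x + 1..x + 1 + k} \<and>
      diffs xs = replicate_mset k x + replicate_mset (k + 1) (x + 1)" if "k \<le> x" for k
    using that
  proof (induction k)
    case 0
    then show ?case by (intro exI[of _ "[0, x + 1]"]) auto
  next
    case (Suc k)
    then obtain xs where xs: "xs \<noteq> []" "hd xs = 0" "last xs = x + 1 + k" "distinct xs"
      "set xs = {0..k} \<union> {x + 1..x + 1 + k}"
      "diffs xs = replicate_mset k x + replicate_mset (k + 1) (x + 1)"
      by auto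
    define ys where "ys = (xs @ [Suc k]) @ [x + 1 + Suc k]"
    have "nat \<bar>int (last xs) - int (Suc k)\<bar> = x" "nat \<bar>int (Suc k) - int (x + 1 + Suc k)\<bar> = x + 1"
      using xs(3) by auto
    then have "diffs ys = add_mset (x + 1) (add_mset x (diffs xs))"
      unfolding ys_def using xs(1) by (simp add: diffs_snoc del: append_assoc)
    then have "diffs ys = replicate_mset (Suc k) x + replicate_mset (Suc k + 1) (x + 1)"
      unfolding xs(6) by simp
    moreover have "set ys = {0..Suc k} \<union> {x + 1..x + 1 + Suc k}"
      unfolding ys_def using xs(5) by (auto simp: le_Suc_eq)
    moreover have "distinct ys"
      unfolding ys_def using xs(4,5) Suc.prems by auto
    ultimately show ?case
      using xs(1,2) by (intro exI[of _ ys]) (auto simp: ys_def)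
  qed
  from this[of x] obtain xs where xs: "xs \<noteq> []" "hd xs = 0" "last xs = x + 1 + x" "distinct xs"
    "set xs = {0..x} \<union> {x + 1..x + 1 + x}"
    "diffs xs = replicate_mset x x + replicate_mset (x + 1) (x + 1)"
    by auto
  have "{0..x} \<union> {x + 1..x + 1 + x} = {0..2 * x + 1}" by auto
  then have "set xs = {0..2 * x + 1}" using xs(5) by (rule trans[rotated])
  moreover have "last xs = 2 * x + 1" using xs(3) by simp
  ultimately show ?thesis unfolding ham_path_def using xs(1,2,4,6) by blast
qed

text \<open>Invariant: unit edges pair off the top \<open>2 * h + 1\<close> vertices except the
  maximal one, where the path ends. A round of \<open>h\<close> detours and one appended vertex adds
  \<open>2 * h + 1\<close> differences \<open>2 * h + 1\<close> and restores this.\<close>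

lemma ham_path_spiral:
  "\<exists>n E. ham_path n E n (replicate_mset (2 * h) 1 + replicate_mset (k * (2 * h + 1)) (2 * h + 1))"
proof -
  have "\<exists>d. ham_path (d + 2 * h) ((\<lambda>i. d + 2 * i) ` {..<h}) (d + 2 * h)
    (replicate_mset (2 * h) 1 + replicate_mset (k * (2 * h + 1)) (2 * h + 1))"
  proof (induction k)
    case 0
    have "(\<lambda>i. 0 + 2 * i) ` {..<h} \<subseteq> {..<2 * h}" by auto
    from ham_path_mono[OF ham_path_run this] show ?case by (intro exI[of _ 0]) simp
  next
    case (Suc k)
    define L where "L = replicate_mset (2 * h) 1 + replicate_mset (k * (2 * h + 1)) (2 * h + 1)"
    obtain d where d: "ham_path (d + 2 * h) ((\<lambda>i. d + 2 * i) ` {..<h}) (d + 2 * h) L"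
      using Suc unfolding L_def by blast
    define n where "n = d + 2 * h"
    have "ham_path (n + 2 * h)
      ((\<lambda>i. Suc n + 2 * i) ` {..<h} \<union> ((\<lambda>i. d + 2 * i) ` {..<h} - (\<lambda>i. d + 2 * i) ` {..<h})) n
      (L + replicate_mset (2 * h) (2 * h + 1))"
      using d unfolding n_def by (intro ham_path_detours) auto
    \<comment> \<open>The detours leave the endpoint at \<open>n\<close>, so the step to the new
      maximum again has length \<open>2 * h + 1\<close>.\<close>
    then have "ham_path (Suc (n + 2 * h)) ((\<lambda>i. Suc n + 2 * i) ` {..<h}) (Suc (n + 2 * h))
      (add_mset (Suc (n + 2 * h) - n) (L + replicate_mset (2 * h) (2 * h + 1)))"
      by (intro ham_path_mono[OF ham_path_append]) auto
    moreover have "add_mset (Suc (n + 2 * h) - n) (L + replicate_mset (2 * h) (2 * h + 1))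
      = replicate_mset (2 * h) 1 + replicate_mset (Suc k * (2 * h + 1)) (2 * h + 1)"
    proof -
      have "Suc k * (2 * h + 1) = k * (2 * h + 1) + 2 * h + 1" by simp
      then show ?thesis unfolding L_def by (simp only: replicate_mset_plus) simp
    qed
    ultimately show ?case by (intro exI[of _ "Suc n"]) simp
  qed
  then show ?thesis by blast
qed

section \<open>The realizations\<close>

lemma ham_path_imp_standard_linear_realization:
  assumes "ham_path n E l L"
  shows "\<exists>xs. standard_linear_realization L xs"
proof -
  obtain xs where xs: "xs \<noteq> []" "hd xs = 0" "distinct xs" "set xs = {0..n}" "diffs xs = L"
    using assms unfolding ham_path_def by blast
  have "length xs = Suc n" using distinct_card[OF xs(3)] xs(4) by simp
  then have "n = size L" "length xs - 1 = size L" using size_diffs[of xs] xs(5) by auto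
  then show ?thesis
    unfolding standard_linear_realization_def linear_realization_def
    using xs diffs_conv_nth[of xs] by (intro exI[of _ xs]) (auto simp: hd_conv_nth)
qed

definition realizable :: "nat multiset \<Rightarrow> bool" where
  "realizable L \<longleftrightarrow> (\<exists>n E l. ham_path n E l L)"

lemma realizable_prefix: "ham_path m E m L \<Longrightarrow> realizable M \<Longrightarrow> realizable (L + M)"
  unfolding realizable_def using ham_path_concat by blast

lemma realizable_few_long:
  assumes "even x" "x > 0" "c \<le> x" "a \<ge> x"
  shows "realizable (replicate_mset a 1 + replicate_mset b x + replicate_mset c (x + 1))"
proof -
  obtain a' where a': "a' \<le> x"
    and "realizable (replicate_mset a' 1 + replicate_mset b x + replicate_mset c (x + 1))"
    using ham_path_few_long[OF assms(1-3)] unfolding realizable_def by blast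
  \<comment> \<open>The missing ones come from a run \<open>0, 1, ..., a - a'\<close> in
    front.\<close>
  from realizable_prefix[OF ham_path_run[of "a - a'"] this(2)] have
    "realizable (replicate_mset (a - a' + a') 1 + replicate_mset b x + replicate_mset c (x + 1))"
    by (simp only: replicate_mset_plus add.assoc)
  then show ?thesis using a' assms(4) by simp
qed

lemma realizable_zigzags:
  assumes "realizable (M + replicate_mset b x + replicate_mset c (x + 1))"
  shows "realizable (M + replicate_mset (k * x + b) x + replicate_mset (k * (x + 1) + c) (x + 1))"
proof (induction k)
  case 0
  then show ?case using assms by simp
next
  case (Suc k)
  have "replicate_mset x x + replicate_mset (x + 1) (x + 1)
    + (M + replicate_mset (k * x + b) x + replicate_mset (k * (x + 1) + c) (x + 1))
    = M + replicate_mset (Suc k * x + b) x + replicate_mset (Suc k * (x + 1) + c) (x + 1)"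
    by (simp only: replicate_mset_plus mult_Suc) (simp only: add_ac)
  then show ?case using realizable_prefix[OF ham_path_zigzag[of x] Suc] by (simp only:)
qed

theorem theorem3p16:
  fixes x a b c :: nat
  assumes "x \<ge> 4" and "even x"
    and "a \<ge> 3 * x - 1 \<or> a \<ge> c + 2 * x - 1 \<or> (b \<ge> c \<and> a \<ge> 2 * x - 1)"
  shows "\<exists>xs. standard_linear_realization
           (replicate_mset a 1 + replicate_mset b x + replicate_mset c (x + 1)) xs"
proof -
  \<comment> \<open>Prefixes absorb \<open>k\<close> full blocks of \<open>x + 1\<close> copies of
    \<open>x + 1\<close>; the remaining \<open>r \<le> x\<close> copies are few.\<close>
  define k r where "k = c div (x + 1)" and "r = c mod (x + 1)"
  have c: "c = k * (x + 1) + r" unfolding k_def r_def by (rule div_mult_mod_eq[symmetric])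
  have r: "r \<le> x" unfolding r_def using mod_less_divisor[of "x + 1" c] by linarith
  \<comment> \<open>The bound \<open>a \<ge> c + 2 * x - 1\<close> gives either \<open>c = 0\<close>
    or \<open>a \<ge> 2 * x\<close>.\<close>
  consider "c \<le> x" "a \<ge> x" | "b \<ge> c" "a \<ge> x" | "a \<ge> 2 * x"
    using assms(1,3) by linarith
  then have "realizable (replicate_mset a 1 + replicate_mset b x + replicate_mset c (x + 1))"
  proof cases
    case 1
    then show ?thesis using realizable_few_long assms by simp
  next
    case 2
    \<comment> \<open>Each zigzag costs \<open>x\<close> copies of \<open>x\<close>, and
      \<open>k * x \<le> c \<le> b\<close>.\<close>
    have "k * x \<le> b" using 2(1) c by simp
    then obtain b' where b': "b = k * x + b'" using le_Suc_ex by blast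
    show ?thesis
      unfolding b' c using realizable_few_long[of x r a b'] r 2(2) assms(1,2)
      by (intro realizable_zigzags) simp
  next
    case 3
    obtain h where h: "x = 2 * h" using assms(2) by blast
    obtain n E where "ham_path n E n (replicate_mset x 1 + replicate_mset (k * (x + 1)) (x + 1))"
      using ham_path_spiral[of h k] unfolding h by blast
    \<comment> \<open>The spiral costs \<open>x\<close> ones once, whatever \<open>k\<close> is; at
      least \<open>x\<close> ones remain for the second piece.\<close>
    moreover have "realizable (replicate_mset (a - x) 1 + replicate_mset b x + replicate_mset r (x + 1))"
      using realizable_few_long[of x r "a - x" b] r 3 assms(1,2) by simp
    ultimately have "realizable (replicate_mset x 1 + replicate_mset (k * (x + 1)) (x + 1)
      + (replicate_mset (a - x) 1 + replicate_mset b x + replicate_mset r (x + 1)))"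
      by (rule realizable_prefix)
    moreover have "replicate_mset x 1 + replicate_mset (k * (x + 1)) (x + 1)
        + (replicate_mset (a - x) 1 + replicate_mset b x + replicate_mset r (x + 1))
      = replicate_mset (x + (a - x)) 1 + replicate_mset b x + replicate_mset (k * (x + 1) + r) (x + 1)"
      by (simp only: replicate_mset_plus add_ac)
    moreover have "x + (a - x) = a" using 3 by simp
    ultimately show ?thesis by (simp only: c[symmetric])
  qed
  then show ?thesis
    unfolding realizable_def using ham_path_imp_standard_linear_realization by blast
qed

end
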